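(* For any normal fuzzy logic program $P$ over a complete lattice $(V,\leqslant)$ and a set of atoms $\Pi$, $\mathit{lfp}(\mathcal{T}_P^{\mathit{st}})\leq_p\mathit{lfp}(\mathcal{U}_P^{\mathit{st}})$.
   Context: Setting. $(V,\leqslant)$ is a complete lattice of truth values with least element $0$ and greatest element $1$; $V'\subseteq V$ is a designated subset of truth values allowed as constants and weights; $\Pi$ is a set of atoms. Each $n$-ary connective $f$ has a truth function $f^{\cdot}\colon V^n\to V$. Truth functions of conjunctors, disjunctors and aggregators are monotone in each argument; a conjunctor $\&$ satisfies $x\mathbin{\&^{\cdot}}y\leqslant x$, $x\mathbin{\&^{\cdot}}y\leqslant y$, $x\mathbin{\&^{\cdot}}1=x=1\mathbin{\&^{\cdot}}x$; a disjunctor $|$ satisfies $x\leqslant x\mathbin{|^{\cdot}}y$, $y\leqslant x\mathbin{|^{\cdot}}y$, $x\mathbin{|^{\cdot}}0=x=0\mathbin{|^{\cdot}}x$. Each implicator $\leftarrow_i$ is paired with a conjunctor $\wedge_i$ (its adjoint partner). Default negation $\sim$ has a truth function $\sim^{\cdot}\colon V\to V$ that is an antimonotone involution. Normal fuzzy formulas are built from constants $c\in V'$, atoms $p$ and negated atoms $\sim p$ ($p\in\Pi$) using conjunctors, disjunctors and aggregators. A normal fuzzy logic program $P$ is a finite set of rules $p\leftarrow_i^{\vartheta}\mathcal{B}$ with head $p\in\Pi$, weight $\vartheta\in V'$ and body $\mathcal{B}$ a normal fuzzy formula. $\mathcal{I}$ is the complete lattice of interpretations $I\colon\Pi\to V$,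 ordered pointwise ($\leq$). On $\mathcal{I}^2$: $(L_1,U_1)\leq_p(L_2,U_2)$ iff $L_1\leq L_2$ and $U_2\leq U_1$. $\hat I(\varphi)$ is the truth-functional evaluation of $\varphi$ under $I$, and $T_P\colon\mathcal{I}\to\mathcal{I}$ is $T_P(I)(p)=\bigvee\{\vartheta\wedge_i^{\cdot}\hat I(\mathcal{B}) : p\leftarrow_i^{\vartheta}\mathcal{B}\in P\}$. Evaluation under a pair $(L,U)\in\mathcal{I}^2$: $\widehat{(L,U)}(c)=c$, $\widehat{(L,U)}(p)=L(p)$, $\widehat{(L,U)}(\sim p)=\sim^{\cdot}U(p)$, and $\widehat{(L,U)}(f(\varphi_1,\dots,\varphi_n))=f^{\cdot}(\widehat{(L,U)}(\varphi_1),\dots,\widehat{(L,U)}(\varphi_n))$. The operator $\mathcal{T}_P\colon\mathcal{I}^2\to\mathcal{I}^2$ is $\mathcal{T}_P(L,U)_1(p)=\bigvee\{\vartheta\wedge_i^{\cdot}\widehat{(L,U)}(\mathcal{B}) : p\leftarrow_i^{\vartheta}\mathcal{B}\in P\}$, $\mathcal{T}_P(L,U)_2=\mathcal{T}_P(U,L)_1$ (subscripts denote components). The ultimate approximator of $T_P$ is $\mathcal{U}_P\colon\mathcal{I}^2\to\mathcal{I}^2$, $\mathcal{U}_P(x,y)=\left(\bigwedge T_P([x,y]),\bigvee T_P([x,y])\right)$, where $T_P([x,y])=\{T_P(z) : x\leq z\leq y\}$ and $\bigwedge,\bigvee$ are glb and lub in $\mathcal{I}$ (so $\bigwedge\emptyset$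 is the greatest and $\bigvee\emptyset$ the least element). For a $\leq_p$-monotone operator $\mathcal{A}$ on $\mathcal{I}^2$ (such as $\mathcal{T}_P$ and $\mathcal{U}_P$), its stable operator is $\mathcal{A}^{\mathit{st}}(x,y)=(\mathit{lfp}(\mathcal{A}(\cdot,y)_1),\mathit{lfp}(\mathcal{A}(x,\cdot)_2))$, least fixpoints of monotone operators on $\mathcal{I}$; $\mathcal{A}^{\mathit{st}}$ is $\leq_p$-monotone and $\mathit{lfp}(\mathcal{A}^{\mathit{st}})$ is its $\leq_p$-least fixpoint. *)

theory Defs
  imports Main
begin

text \<open>
  The complete lattice of truth values is a type of class \<open>complete_lattice\<close>, and the set of atoms
  is a type. The symbols for conjunctors, disjunctors, aggregators and implicators range over the types
  \<open>'k\<close>, \<open>'d\<close>, \<open>'g\<close>, \<open>'i\<close>. The field \<open>truth_consts\<close> is the designated subset of truth values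
  admitted as constants and weights.

  The truth function of an aggregator \<open>g\<close> is only meaningful on lists of length \<open>arity S g\<close>.
  An implicator enters the semantics of a rule only through its partner conjunctor, so truth
  functions of implicators are not recorded and no adjointness condition is imposed.
\<close>

record ('v, 'k, 'd, 'g, 'i) connectives =
  truth_consts :: "'v set"
  conj_fun :: "'k \<Rightarrow> 'v \<Rightarrow> 'v \<Rightarrow> 'v"
  disj_fun :: "'d \<Rightarrow> 'v \<Rightarrow> 'v \<Rightarrow> 'v"
  arity :: "'g \<Rightarrow> nat"
  agg_fun :: "'g \<Rightarrow> 'v list \<Rightarrow> 'v"
  partner :: "'i \<Rightarrow> 'k"
  neg_fun :: "'v \<Rightarrow> 'v"

definition conjunctor :: "('v::complete_lattice \<Rightarrow> 'v \<Rightarrow> 'v) \<Rightarrow> bool" where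
  "conjunctor c \<longleftrightarrow>
     (\<forall>y. mono (\<lambda>x. c x y)) \<and> (\<forall>x. mono (\<lambda>y. c x y)) \<and>
     (\<forall>x y. c x y \<le> x \<and> c x y \<le> y) \<and>
     (\<forall>x. c x top = x \<and> c top x = x)"

definition disjunctor :: "('v::complete_lattice \<Rightarrow> 'v \<Rightarrow> 'v) \<Rightarrow> bool" where
  "disjunctor d \<longleftrightarrow>
     (\<forall>y. mono (\<lambda>x. d x y)) \<and> (\<forall>x. mono (\<lambda>y. d x y)) \<and>
     (\<forall>x y. x \<le> d x y \<and> y \<le> d x y) \<and>
     (\<forall>x. d x bot = x \<and> d bot x = x)"

definition aggregator :: "nat \<Rightarrow> ('v::complete_lattice list \<Rightarrow> 'v) \<Rightarrow> bool" where
  "aggregator n a \<longleftrightarrow>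
     (\<forall>xs i. length xs = n \<longrightarrow> i < n \<longrightarrow> mono (\<lambda>x. a (xs[i := x])))"

definition default_negation :: "('v::complete_lattice \<Rightarrow> 'v) \<Rightarrow> bool" where
  "default_negation n \<longleftrightarrow> antimono n \<and> (\<forall>x. n (n x) = x)"

definition wf_connectives :: "('v::complete_lattice, 'k, 'd, 'g, 'i) connectives \<Rightarrow> bool" where
  "wf_connectives S \<longleftrightarrow>
     (\<forall>k. conjunctor (conj_fun S k)) \<and>
     (\<forall>d. disjunctor (disj_fun S d)) \<and>
     (\<forall>g. aggregator (arity S g) (agg_fun S g)) \<and>
     default_negation (neg_fun S)"

datatype ('p, 'v, 'k, 'd, 'g) formula =
    Const 'v
  | Atom 'p
  | NegAtom 'p
  | Conj 'k "('p, 'v, 'k, 'd, 'g) formula" "('p, 'v, 'k, 'd, 'g) formula"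
  | Disj 'd "('p, 'v, 'k, 'd, 'g) formula" "('p, 'v, 'k, 'd, 'g) formula"
  | Agg 'g "('p, 'v, 'k, 'd, 'g) formula list"

fun normal_formula ::
  "('v::complete_lattice, 'k, 'd, 'g, 'i) connectives \<Rightarrow> ('p, 'v, 'k, 'd, 'g) formula \<Rightarrow> bool" where
  "normal_formula S (Const c) \<longleftrightarrow> c \<in> truth_consts S"
| "normal_formula S (Atom p) \<longleftrightarrow> True"
| "normal_formula S (NegAtom p) \<longleftrightarrow> True"
| "normal_formula S (Conj k \<phi> \<psi>) \<longleftrightarrow> normal_formula S \<phi> \<and> normal_formula S \<psi>"
| "normal_formula S (Disj d \<phi> \<psi>) \<longleftrightarrow> normal_formula S \<phi> \<and> normal_formula S \<psi>"
| "normal_formula S (Agg g \<phi>s) \<longleftrightarrow>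
     length \<phi>s = arity S g \<and> (\<forall>\<phi>\<in>set \<phi>s. normal_formula S \<phi>)"

datatype ('p, 'v, 'k, 'd, 'g, 'i) rule =
  Rule (head: 'p) (implicator: 'i) (weight: 'v) (body: "('p, 'v, 'k, 'd, 'g) formula")

definition normal_program ::
  "('v::complete_lattice, 'k, 'd, 'g, 'i) connectives \<Rightarrow> ('p, 'v, 'k, 'd, 'g, 'i) rule set \<Rightarrow> bool"
where
  "normal_program S P \<longleftrightarrow>
     finite P \<and> (\<forall>r\<in>P. weight r \<in> truth_consts S \<and> normal_formula S (body r))"

fun eval ::
  "('v::complete_lattice, 'k, 'd, 'g, 'i) connectives \<Rightarrow> ('p \<Rightarrow> 'v) \<Rightarrow>
   ('p, 'v, 'k, 'd, 'g) formula \<Rightarrow> 'v" where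
  "eval S I (Const c) = c"
| "eval S I (Atom p) = I p"
| "eval S I (NegAtom p) = neg_fun S (I p)"
| "eval S I (Conj k \<phi> \<psi>) = conj_fun S k (eval S I \<phi>) (eval S I \<psi>)"
| "eval S I (Disj d \<phi> \<psi>) = disj_fun S d (eval S I \<phi>) (eval S I \<psi>)"
| "eval S I (Agg g \<phi>s) = agg_fun S g (map (eval S I) \<phi>s)"

fun eval_pair ::
  "('v::complete_lattice, 'k, 'd, 'g, 'i) connectives \<Rightarrow> ('p \<Rightarrow> 'v) \<times> ('p \<Rightarrow> 'v) \<Rightarrow>
   ('p, 'v, 'k, 'd, 'g) formula \<Rightarrow> 'v" where
  "eval_pair S (L, U) (Const c) = c"
| "eval_pair S (L, U) (Atom p) = L p"
| "eval_pair S (L, U) (NegAtom p) = neg_fun S (U p)"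
| "eval_pair S (L, U) (Conj k \<phi> \<psi>) =
     conj_fun S k (eval_pair S (L, U) \<phi>) (eval_pair S (L, U) \<psi>)"
| "eval_pair S (L, U) (Disj d \<phi> \<psi>) =
     disj_fun S d (eval_pair S (L, U) \<phi>) (eval_pair S (L, U) \<psi>)"
| "eval_pair S (L, U) (Agg g \<phi>s) = agg_fun S g (map (eval_pair S (L, U)) \<phi>s)"

definition T_op ::
  "('v::complete_lattice, 'k, 'd, 'g, 'i) connectives \<Rightarrow> ('p, 'v, 'k, 'd, 'g, 'i) rule set \<Rightarrow>
   ('p \<Rightarrow> 'v) \<Rightarrow> ('p \<Rightarrow> 'v)" where
  "T_op S P I =
     (\<lambda>p. Sup {conj_fun S (partner S (implicator r)) (weight r) (eval S I (body r)) | r.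
               r \<in> P \<and> head r = p})"

definition T_pair_lower ::
  "('v::complete_lattice, 'k, 'd, 'g, 'i) connectives \<Rightarrow> ('p, 'v, 'k, 'd, 'g, 'i) rule set \<Rightarrow>
   ('p \<Rightarrow> 'v) \<times> ('p \<Rightarrow> 'v) \<Rightarrow> ('p \<Rightarrow> 'v)" where
  "T_pair_lower S P LU =
     (\<lambda>p. Sup {conj_fun S (partner S (implicator r)) (weight r) (eval_pair S LU (body r)) | r.
               r \<in> P \<and> head r = p})"

definition T_approx ::
  "('v::complete_lattice, 'k, 'd, 'g, 'i) connectives \<Rightarrow> ('p, 'v, 'k, 'd, 'g, 'i) rule set \<Rightarrow>
   ('p \<Rightarrow> 'v) \<times> ('p \<Rightarrow> 'v) \<Rightarrow> ('p \<Rightarrow> 'v) \<times> ('p \<Rightarrow> 'v)" where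
  "T_approx S P = (\<lambda>(L, U). (T_pair_lower S P (L, U), T_pair_lower S P (U, L)))"

text \<open>
  Defined over an arbitrary complete lattice \<open>'a\<close>, which is instantiated by the pointwise ordered
  interpretations \<open>'p \<Rightarrow> 'v\<close>. The order \<open>\<le>\<^sub>p\<close> differs from the library's componentwise order on
  products.
\<close>

definition prec_le :: "'a::complete_lattice \<times> 'a \<Rightarrow> 'a \<times> 'a \<Rightarrow> bool" (infix \<open>\<le>\<^sub>p\<close> 50) where
  "x \<le>\<^sub>p y \<longleftrightarrow> fst x \<le> fst y \<and> snd y \<le> snd x"

definition ultimate ::
  "('a::complete_lattice \<Rightarrow> 'a) \<Rightarrow> 'a \<times> 'a \<Rightarrow> 'a \<times> 'a" where
  "ultimate T = (\<lambda>(x, y). (Inf (T ` {x..y}), Sup (T ` {x..y})))"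

definition stable_op ::
  "('a::complete_lattice \<times> 'a \<Rightarrow> 'a \<times> 'a) \<Rightarrow> 'a \<times> 'a \<Rightarrow> 'a \<times> 'a" where
  "stable_op A = (\<lambda>(x, y). (lfp (\<lambda>z. fst (A (z, y))), lfp (\<lambda>z. snd (A (x, z)))))"

definition lfp_p :: "('a::complete_lattice \<times> 'a \<Rightarrow> 'a \<times> 'a) \<Rightarrow> 'a \<times> 'a" where
  "lfp_p A = (THE x. A x = x \<and> (\<forall>y. A y = y \<longrightarrow> x \<le>\<^sub>p y))"

text \<open>
  The definite description is meaningful for \<open>\<le>\<^sub>p\<close>-monotone operators, and the operators to which
  it is applied are \<open>\<le>\<^sub>p\<close>-monotone. The same monotonicity justifies the uses of \<open>lfp\<close> in
  \<open>stable_op\<close>.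
\<close>

definition prec_mono :: "('a::complete_lattice \<times> 'a \<Rightarrow> 'a \<times> 'a) \<Rightarrow> bool" where
  "prec_mono A \<longleftrightarrow> (\<forall>x y. x \<le>\<^sub>p y \<longrightarrow> A x \<le>\<^sub>p A y)"

lemma lfp_p_least_fixpoint:
  assumes "prec_mono A"
  shows "A (lfp_p A) = lfp_p A" and "A y = y \<Longrightarrow> lfp_p A \<le>\<^sub>p y"
proof -
  have antisym: "x = y" if "x \<le>\<^sub>p y" "y \<le>\<^sub>p x" for x y :: "'a \<times> 'a"
    using that by (auto simp: prec_le_def prod_eq_iff)
  have trans: "x \<le>\<^sub>p z" if "x \<le>\<^sub>p y" "y \<le>\<^sub>p z" for x y z :: "'a \<times> 'a"
    using that by (auto simp: prec_le_def intro: order_trans)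
  define m where "m = (Inf (fst ` {u. A u \<le>\<^sub>p u}), Sup (snd ` {u. A u \<le>\<^sub>p u}))"
  have lower: "m \<le>\<^sub>p u" if "A u \<le>\<^sub>p u" for u
    using that by (auto simp: m_def prec_le_def intro!: Inf_lower Sup_upper)
  have greatest: "w \<le>\<^sub>p m" if "\<And>u. A u \<le>\<^sub>p u \<Longrightarrow> w \<le>\<^sub>p u" for w
    using that unfolding m_def prec_le_def by (auto intro!: Inf_greatest Sup_least)
  have pre: "A m \<le>\<^sub>p m"
    using assms lower trans unfolding prec_mono_def by (blast intro: greatest)
  then have "A (A m) \<le>\<^sub>p A m"
    using assms unfolding prec_mono_def by blast
  then have fix_m: "A m = m"
    using pre lower antisym by blast
  have least_m: "m \<le>\<^sub>p y" if "A y = y" for y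
    using lower[of y] that by (simp add: prec_le_def)
  have "lfp_p A = m"
    unfolding lfp_p_def using fix_m least_m antisym by (intro the_equality) blast+
  with fix_m least_m show "A (lfp_p A) = lfp_p A" and "A y = y \<Longrightarrow> lfp_p A \<le>\<^sub>p y"
    by simp_all
qed

lemma prec_mono_stable_op:
  assumes "prec_mono A"
  shows "prec_mono (stable_op A)"
  using assms unfolding prec_mono_def prec_le_def stable_op_def
  by (auto intro!: lfp_mono)

lemma prec_mono_ultimate: "prec_mono (ultimate T)"
  unfolding prec_mono_def prec_le_def ultimate_def
  by (auto intro!: Inf_superset_mono Sup_subset_mono image_mono)

lemma aggregator_mono:
  assumes "aggregator n a" and "length xs = n" and "list_all2 (\<le>) xs ys"
  shows "a xs \<le> a ys"
proof -
  have len: "length ys = n"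
    using assms list_all2_lengthD by force
  have "a xs \<le> a (take k ys @ drop k xs)" if "k \<le> n" for k
    using that
  proof (induction k)
    case (Suc k)
    let ?zs = "take k ys @ drop k xs"
    have zs: "length ?zs = n" "k < n" "?zs[k := xs ! k] = ?zs"
      using Suc.prems assms(2) len by (auto simp: list_eq_iff_nth_eq nth_list_update nth_append)
    have "?zs[k := ys ! k] = take (Suc k) ys @ drop (Suc k) xs"
      using zs(2) assms(2) len
      by (intro nth_equalityI) (auto simp: nth_list_update nth_append less_Suc_eq)
    moreover have "a (?zs[k := xs ! k]) \<le> a (?zs[k := ys ! k])"
      using assms zs unfolding aggregator_def mono_def
      by (metis list_all2_nthD)
    ultimately show ?case
      using Suc zs by (metis Suc_leD order_trans)
  qed simp
  from this[of n] show ?thesis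
    using assms(2) len by simp
qed

lemma eval_pair_mono:
  assumes "wf_connectives S" and "normal_formula S \<phi>" and "L \<le> L'" and "U' \<le> U"
  shows "eval_pair S (L, U) \<phi> \<le> eval_pair S (L', U') \<phi>"
  using assms(2)
proof (induction \<phi>)
  case (NegAtom p)
  then show ?case
    using assms(1,4)
    by (auto simp: wf_connectives_def default_negation_def le_fun_def antimono_def)
next
  case (Conj k \<phi> \<psi>)
  then show ?case
    using assms(1) unfolding wf_connectives_def conjunctor_def mono_def
    by simp (meson order_trans)
next
  case (Disj d \<phi> \<psi>)
  then show ?case
    using assms(1) unfolding wf_connectives_def disjunctor_def mono_def
    by simp (meson order_trans)
next
  case (Agg g \<phi>s)
  have "aggregator (arity S g) (agg_fun S g)"
    using assms(1) by (simp add: wf_connectives_def)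
  with Agg show ?case
    by (auto intro!: aggregator_mono simp: list_all2_conv_all_nth)
qed (use assms(3) in \<open>auto simp: le_fun_def\<close>)

lemma prec_mono_T_approx:
  assumes "wf_connectives S" and "normal_program S P"
  shows "prec_mono (T_approx S P)"
proof -
  have "T_pair_lower S P (L, U) \<le> T_pair_lower S P (L', U')" if "L \<le> L'" "U' \<le> U" for L U L' U'
    unfolding T_pair_lower_def le_fun_def
  proof (intro allI Sup_mono, clarify)
    fix r assume r: "r \<in> P"
    have "eval_pair S (L, U) (body r) \<le> eval_pair S (L', U') (body r)"
      using eval_pair_mono assms that r by (metis normal_program_def)
    then have "conj_fun S (partner S (implicator r)) (weight r) (eval_pair S (L, U) (body r))
      \<le> conj_fun S (partner S (implicator r)) (weight r) (eval_pair S (L', U') (body r))"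
      using assms(1) by (auto simp: wf_connectives_def conjunctor_def mono_def)
    then show "\<exists>v\<in>{conj_fun S (partner S (implicator r')) (weight r')
        (eval_pair S (L', U') (body r')) | r'. r' \<in> P \<and> head r' = head r}.
      conj_fun S (partner S (implicator r)) (weight r) (eval_pair S (L, U) (body r)) \<le> v"
      using r by blast
  qed
  then show ?thesis
    by (auto simp: prec_mono_def prec_le_def T_approx_def)
qed

end

theory Submission
  imports Defs
begin

text \<open>
  Every \<open>z\<close> with \<open>x \<le> z \<le> y\<close> satisfies \<open>(x, y) \<le>\<^sub>p (z, z)\<close>, and \<open>T_approx\<close> maps \<open>(z, z)\<close> to
  \<open>(T z, T z)\<close>, so \<open>T_approx\<close> lies \<open>\<le>\<^sub>p\<close>-below the ultimate approximator pointwise. This also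
  holds at inconsistent pairs, where the ultimate approximator takes the greatest value
  \<open>(top, bot)\<close>. Stable operators and \<open>\<le>\<^sub>p\<close>-least fixpoints preserve the comparison.
\<close>

lemma prec_le_trans: "x \<le>\<^sub>p y \<Longrightarrow> y \<le>\<^sub>p z \<Longrightarrow> x \<le>\<^sub>p z"
  by (auto simp: prec_le_def intro: order_trans)

text \<open>\<open>lfp_p\<close> is characterised through fixpoints only, so \<open>A\<close> is
  capped at the prefixed point \<open>y\<close>: the least fixpoint of the capped operator lies
  below \<open>y\<close> and is a fixpoint of \<open>A\<close>.\<close>

lemma lfp_p_lowerbound:
  assumes mono: "prec_mono A" and pre: "A y \<le>\<^sub>p y"
  shows "lfp_p A \<le>\<^sub>p y"
proof -
  \<comment> \<open>The meet of \<open>A u\<close> and \<open>y\<close> in the order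
    \<open>\<le>\<^sub>p\<close>.\<close>
  define B where "B u = (inf (fst (A u)) (fst y), sup (snd (A u)) (snd y))" for u
  have "prec_mono B"
    using mono unfolding prec_mono_def prec_le_def B_def
    by (auto intro: le_infI1 le_supI1)
  then have fix_w: "B (lfp_p B) = lfp_p B"
    by (rule lfp_p_least_fixpoint)
  let ?w = "lfp_p B"
  have below: "?w \<le>\<^sub>p y"
    by (subst fix_w[symmetric]) (simp add: B_def prec_le_def)
  \<comment> \<open>Since \<open>A ?w \<le>\<^sub>p A y \<le>\<^sub>p y\<close>, the cap has no
    effect at \<open>?w\<close>.\<close>
  then have "A ?w \<le>\<^sub>p y"
    using mono pre prec_le_trans unfolding prec_mono_def by blast
  then have "B ?w = A ?w"
    by (simp add: B_def prec_le_def prod_eq_iff inf_absorb1 sup_absorb1)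
  then show ?thesis
    using lfp_p_least_fixpoint(2)[OF mono] fix_w below prec_le_trans by metis
qed

text \<open>The least fixpoint of \<open>B\<close> is a prefixed point of \<open>A\<close>.\<close>

lemma lfp_p_mono:
  assumes "prec_mono A" "prec_mono B" and "\<And>x. A x \<le>\<^sub>p B x"
  shows "lfp_p A \<le>\<^sub>p lfp_p B"
  using lfp_p_lowerbound[OF assms(1)] assms(3)[of "lfp_p B"]
    lfp_p_least_fixpoint(1)[OF assms(2)] by simp

lemma stable_op_mono:
  assumes "\<And>x. A x \<le>\<^sub>p B x"
  shows "stable_op A x \<le>\<^sub>p stable_op B x"
  using assms unfolding prec_le_def stable_op_def
  by (auto split: prod.split intro!: lfp_mono)

lemma prec_le_ultimate:
  assumes "prec_mono A" and "\<And>z. A (z, z) = (T z, T z)"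
  shows "A x \<le>\<^sub>p ultimate T x"
proof (cases x)
  case (Pair l u)
  have "A (l, u) \<le>\<^sub>p (T z, T z)" if "z \<in> {l..u}" for z
    using assms that unfolding prec_mono_def
    by (metis prec_le_def fst_conv snd_conv atLeastAtMost_iff)
  then show ?thesis
    unfolding Pair ultimate_def prec_le_def
    by (auto intro!: INF_greatest SUP_least)
qed

lemma eval_pair_diagonal: "eval_pair S (I, I) \<phi> = eval S I \<phi>"
  by (induction \<phi>) (auto cong: map_cong)

lemma T_approx_diagonal: "T_approx S P (I, I) = (T_op S P I, T_op S P I)"
  by (simp add: T_approx_def T_pair_lower_def T_op_def eval_pair_diagonal)

theorem proposition13:
  fixes S :: "('v::complete_lattice, 'k, 'd, 'g, 'i) connectives"
    and P :: "('p, 'v, 'k, 'd, 'g, 'i) rule set"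
  assumes "wf_connectives S"
    and "normal_program S P"
  shows "lfp_p (stable_op (T_approx S P)) \<le>\<^sub>p lfp_p (stable_op (ultimate (T_op S P)))"
  using prec_mono_T_approx[OF assms]
  by (intro lfp_p_mono stable_op_mono prec_mono_stable_op prec_mono_ultimate
      prec_le_ultimate T_approx_diagonal)

end
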